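(* Let $(X,d)$ be a metric space. The following are equivalent. (a) $(X,d)$ is complete. (b) For every Banach space $(Y,\|\cdot\|)$, each continuous TB-regular function from $(X,d)$ to $(Y,\|\cdot\|)$ can be uniformly approximated by Cauchy-Lipschitz functions. (c) Each real-valued continuous TB-regular function on $(X,d)$ can be uniformly approximated by Cauchy-Lipschitz functions.
   Context: A subset $A$ of a metric space $(X,d)$ is totally bounded if for every $\epsilon>0$ there is a finite set $\{x_1,\dots,x_n\}\subseteq X$ with $A\subseteq\bigcup_{i=1}^n B(x_i,\epsilon)$, where $B(x,\epsilon)$ is the open ball. A function $f:(X,d)\to(Y,\rho)$ between metric spaces is TB-regular if $f(A)$ is totally bounded for every totally bounded subset $A$ of $X$. It is Cauchy-Lipschitz if $f$ is Lipschitz when restricted to the range $\{x_n:n\in\mathbb{N}\}$ of each Cauchy sequence $(x_n)$ in $X$. A function $f:X\to Y$ into a Banach space (or $\mathbb{R}$) can be uniformly approximated by Cauchy-Lipschitz functions if for every $\epsilon>0$ there is a Cauchy-Lipschitz function $g:X\to Y$ with $\sup_{x\in X}\|f(x)-g(x)\|<\epsilon$. *)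

theory Defs
  imports "HOL-Analysis.Analysis" "HOL-Algebra.Module" "HOL-Algebra.Algebraic_Closure_Type"
begin

section \<open>Banach spaces with explicit carrier\<close>

text \<open>
  Quantifying over all Banach spaces inside a formula is impossible with the type class
  \<^class>\<open>banach\<close>, so Banach spaces are modules over the field of real numbers, with a norm, whose
  carrier is an arbitrary subset of a type. Any type that is the ambient type of a nonzero such space
  has at least the cardinality of the reals; a smaller type carries the zero space only, and
  quantifying over its Banach spaces says nothing. As everywhere in HOL-Algebra, the fields for the
  multiplication and the unit of the underlying ring record are not used by modules.
\<close>

record 'v normed_module = "(real, 'v) module" +
  nrm :: "'v \<Rightarrow> real"

abbreviation real_field :: "real ring"
  where "real_field \<equiv> ring_of_type_algebra"

locale real_normed_space = module real_field V for V :: "('v, 'm) normed_module_scheme" (structure) +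
  assumes nrm_eq_zero: "x \<in> carrier V \<Longrightarrow> nrm V x = 0 \<longleftrightarrow> x = \<zero>"
    and nrm_smult: "x \<in> carrier V \<Longrightarrow> nrm V (a \<odot> x) = \<bar>a\<bar> * nrm V x"
    and nrm_triangle: "\<lbrakk>x \<in> carrier V; y \<in> carrier V\<rbrakk> \<Longrightarrow> nrm V (x \<oplus> y) \<le> nrm V x + nrm V y"

text \<open>
  The distance is set to 0 outside the carrier because \<^locale>\<open>Metric_space\<close> requires
  nonnegativity and symmetry on the whole type.
\<close>

definition norm_dist :: "('v, 'm) normed_module_scheme \<Rightarrow> 'v \<Rightarrow> 'v \<Rightarrow> real"
  where "norm_dist V x y = (if x \<in> carrier V \<and> y \<in> carrier V then nrm V (x \<ominus>\<^bsub>V\<^esub> y) else 0)"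

definition norm_metric :: "('v, 'm) normed_module_scheme \<Rightarrow> 'v metric"
  where "norm_metric V = metric (carrier V, norm_dist V)"

locale banach_space = real_normed_space +
  assumes complete: "mcomplete_of (norm_metric V)"

context real_normed_space
begin

lemma nrm_uminus: assumes "x \<in> carrier V" shows "nrm V (\<ominus> x) = nrm V x"
proof -
  have R: "carrier real_field = UNIV" "\<one>\<^bsub>real_field\<^esub> = 1" "\<zero>\<^bsub>real_field\<^esub> = 0"
    "\<And>a b. a \<oplus>\<^bsub>real_field\<^esub> b = a + b"
    by (simp_all add: ring_of_type_algebra_def)
  have "\<ominus>\<^bsub>real_field\<^esub> 1 = (-1::real)"
    by (rule R.minus_equality) (simp_all add: R)
  moreover have "(\<ominus>\<^bsub>real_field\<^esub> 1) \<odot> x = \<ominus> ((1::real) \<odot> x)"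
    using smult_l_minus[of 1 x] assms by (simp add: R)
  moreover have "(1::real) \<odot> x = x"
    using smult_one[OF assms] by (simp add: R)
  ultimately show ?thesis
    using nrm_smult[OF assms, of "-1"] by simp
qed

lemma nrm_nonneg: assumes "x \<in> carrier V" shows "0 \<le> nrm V x"
proof -
  have "nrm V (x \<oplus> \<ominus> x) \<le> nrm V x + nrm V (\<ominus> x)"
    using assms by (intro nrm_triangle) auto
  moreover have "nrm V (x \<oplus> \<ominus> x) = 0"
    using assms by (simp add: M.r_neg nrm_eq_zero)
  ultimately show ?thesis
    using nrm_uminus[OF assms] by simp
qed

lemma Metric_space_norm_dist: "Metric_space (carrier V) (norm_dist V)"
proof
  fix x y
  show "0 \<le> norm_dist V x y"
    by (simp add: norm_dist_def nrm_nonneg)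
  show "norm_dist V x y = norm_dist V y x"
  proof (cases "x \<in> carrier V \<and> y \<in> carrier V")
    case True
    then have "\<ominus> (x \<ominus> y) = y \<ominus> x"
      by (simp add: a_minus_def M.minus_add M.a_comm)
    then show ?thesis
      using nrm_uminus[of "x \<ominus> y"] True by (simp add: norm_dist_def)
  qed (auto simp: norm_dist_def)
next
  fix x y assume "x \<in> carrier V" "y \<in> carrier V"
  moreover from this have "x \<ominus> y = \<zero> \<longleftrightarrow> x = y"
    by (metis a_minus_def M.minus_equality M.minus_minus M.r_neg M.a_inv_closed)
  ultimately show "norm_dist V x y = 0 \<longleftrightarrow> x = y"
    by (simp add: norm_dist_def nrm_eq_zero)
next
  fix x y z assume A: "x \<in> carrier V" "y \<in> carrier V" "z \<in> carrier V"
  have "(x \<ominus> y) \<oplus> (y \<ominus> z) = x \<oplus> (\<ominus> y \<oplus> (y \<oplus> \<ominus> z))"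
    using A by (simp add: a_minus_def M.a_assoc)
  also have "\<dots> = x \<ominus> z"
    using A by (simp add: a_minus_def M.r_neg1)
  finally show "norm_dist V x z \<le> norm_dist V x y + norm_dist V y z"
    using nrm_triangle[of "x \<ominus> y" "y \<ominus> z"] A by (simp add: norm_dist_def)
qed

lemma mspace_norm_metric [simp]: "mspace (norm_metric V) = carrier V"
  by (simp add: norm_metric_def Metric_space.mspace_metric[OF Metric_space_norm_dist])

lemma mdist_norm_metric:
  "\<lbrakk>x \<in> carrier V; y \<in> carrier V\<rbrakk> \<Longrightarrow> mdist (norm_metric V) x y = nrm V (x \<ominus> y)"
  by (simp add: norm_metric_def Metric_space.mdist_metric[OF Metric_space_norm_dist] norm_dist_def)

end

text \<open>Every Banach space in the sense of the type class is one in the present sense.\<close>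

definition class_banach :: "'b::real_normed_vector normed_module"
  where "class_banach = \<lparr>carrier = UNIV, mult = (\<lambda>x y. 0), one = 0, zero = 0, add = (+),
    smult = (*\<^sub>R), nrm = norm\<rparr>"

lemma real_normed_space_class_banach:
  "real_normed_space (class_banach :: 'b::real_normed_vector normed_module)"
proof -
  have "module real_field (class_banach :: 'b normed_module)"
  proof (rule moduleI)
    show "cring real_field"
      by (rule cring_from_type_algebra)
    show "abelian_group (class_banach :: 'b normed_module)"
    proof (rule abelian_groupI)
      fix x :: 'b
      show "\<exists>y\<in>carrier class_banach. y \<oplus>\<^bsub>class_banach\<^esub> x = \<zero>\<^bsub>class_banach\<^esub>"
        by (rule bexI[of _ "- x"]) (simp_all add: class_banach_def)
    qed (simp_all add: class_banach_def algebra_simps)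
  qed (simp_all add: class_banach_def ring_of_type_algebra_def algebra_simps)
  then show ?thesis
    by (intro real_normed_space.intro real_normed_space_axioms.intro)
      (simp_all add: class_banach_def norm_triangle_ineq)
qed

lemma norm_metric_class_banach: "norm_metric (class_banach :: 'b::real_normed_vector normed_module) = euclidean_metric"
proof -
  interpret B: real_normed_space "class_banach :: 'b normed_module"
    by (rule real_normed_space_class_banach)
  have car: "carrier (class_banach :: 'b normed_module) = UNIV"
    by (simp add: class_banach_def)
  have "\<ominus>\<^bsub>class_banach\<^esub> y = - y" for y :: 'b
    by (rule B.M.minus_equality) (simp_all add: class_banach_def)
  then have "norm_dist class_banach x y = dist x y" for x y :: 'b
    by (simp add: norm_dist_def car a_minus_def dist_norm) (simp add: class_banach_def)
  then have "norm_dist class_banach = (dist :: 'b \<Rightarrow> 'b \<Rightarrow> real)"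
    by (intro ext)
  then show ?thesis
    by (simp add: norm_metric_def euclidean_metric_def car)
qed

lemma banach_space_class_banach: "banach_space (class_banach :: 'b::banach normed_module)"
  by (intro banach_space.intro banach_space_axioms.intro real_normed_space_class_banach)
    (simp add: norm_metric_class_banach mcomplete_of_def complete_UNIV)

section \<open>Classes of functions between metric spaces\<close>

definition TB_regular :: "'a metric \<Rightarrow> 'b metric \<Rightarrow> ('a \<Rightarrow> 'b) \<Rightarrow> bool"
  where "TB_regular m1 m2 f \<longleftrightarrow> f \<in> mspace m1 \<rightarrow> mspace m2 \<and>
    (\<forall>A. Metric_space.mtotally_bounded (mspace m1) (mdist m1) A \<longrightarrow>
         Metric_space.mtotally_bounded (mspace m2) (mdist m2) (f ` A))"

text \<open>
  The library requires the centres of the covering balls to lie in the set itself; this is the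
  same as allowing arbitrary centres.
\<close>

lemma (in Metric_space) mtotally_bounded_centres:
  "mtotally_bounded A \<longleftrightarrow> A \<subseteq> M \<and> (\<forall>\<epsilon>>0. \<exists>K. finite K \<and> K \<subseteq> M \<and> A \<subseteq> (\<Union>x\<in>K. mball x \<epsilon>))"
proof
  assume "mtotally_bounded A"
  then show "A \<subseteq> M \<and> (\<forall>\<epsilon>>0. \<exists>K. finite K \<and> K \<subseteq> M \<and> A \<subseteq> (\<Union>x\<in>K. mball x \<epsilon>))"
    using mtotally_bounded_imp_subset unfolding mtotally_bounded_def by (meson order_trans)
next
  assume R: "A \<subseteq> M \<and> (\<forall>\<epsilon>>0. \<exists>K. finite K \<and> K \<subseteq> M \<and> A \<subseteq> (\<Union>x\<in>K. mball x \<epsilon>))"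
  show "mtotally_bounded A"
    unfolding mtotally_bounded_def
  proof (intro allI impI)
    fix \<epsilon> :: real assume "\<epsilon> > 0"
    then obtain K where K: "finite K" "A \<subseteq> (\<Union>x\<in>K. mball x (\<epsilon>/2))"
      using R by (meson half_gt_zero)
    define L where "L = {x \<in> K. mball x (\<epsilon>/2) \<inter> A \<noteq> {}}"
    have "\<forall>x\<in>L. \<exists>a. a \<in> mball x (\<epsilon>/2) \<inter> A"
      by (auto simp: L_def)
    then obtain c where c: "\<And>x. x \<in> L \<Longrightarrow> c x \<in> mball x (\<epsilon>/2) \<inter> A"
      by metis
    have "A \<subseteq> (\<Union>y\<in>c ` L. mball y \<epsilon>)"
    proof
      fix a assume a: "a \<in> A"
      then obtain x where x: "x \<in> K" "a \<in> mball x (\<epsilon>/2)"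
        using K by auto
      then have "x \<in> L" using a by (auto simp: L_def)
      from c[OF this] x have "d (c x) a < \<epsilon>" "c x \<in> M" "a \<in> M"
        using triangle[of "c x" x a] commute[of "c x" x] by auto
      then show "a \<in> (\<Union>y\<in>c ` L. mball y \<epsilon>)"
        using \<open>x \<in> L\<close> by auto
    qed
    moreover have "finite (c ` L)" "c ` L \<subseteq> A"
      using K c by (auto simp: L_def)
    ultimately show "\<exists>K. finite K \<and> K \<subseteq> A \<and> A \<subseteq> (\<Union>x\<in>K. mball x \<epsilon>)"
      by blast
  qed
qed

definition Cauchy_Lipschitz :: "'a metric \<Rightarrow> 'b metric \<Rightarrow> ('a \<Rightarrow> 'b) \<Rightarrow> bool"
  where "Cauchy_Lipschitz m1 m2 f \<longleftrightarrow> f \<in> mspace m1 \<rightarrow> mspace m2 \<and>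
    (\<forall>\<sigma>. Metric_space.MCauchy (mspace m1) (mdist m1) \<sigma> \<longrightarrow>
         Lipschitz_continuous_map (submetric m1 (range \<sigma>)) m2 f)"

text \<open>
  The supremum is taken in the extended reals, so that it is infinite, and not unspecified, for an
  unbounded difference.
\<close>

definition CL_approximable :: "'a metric \<Rightarrow> 'b metric \<Rightarrow> ('a \<Rightarrow> 'b) \<Rightarrow> bool"
  where "CL_approximable m1 m2 f \<longleftrightarrow>
    (\<forall>\<epsilon>>0. \<exists>g. Cauchy_Lipschitz m1 m2 g \<and>
           (SUP x \<in> mspace m1. ereal (mdist m2 (f x) (g x))) < ereal \<epsilon>)"

end

theory Submission
  imports Defs
begin

text \<open>
  A continuous map \<open>f\<close> from any metric space to a normed space is a uniform limit of locally
  Lipschitz maps (lemma \<open>locally_Lipschitz_approximation\<close>). In a complete space every Cauchy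
  sequence converges, and a locally Lipschitz map is Lipschitz on a convergent sequence with all its
  terms: a closed ball around the limit, on which the map is Lipschitz, contains all but finitely
  many of them (lemma \<open>locally_Lipschitz_imp_Cauchy_Lipschitz\<close>). So completeness implies both
  approximation properties.

  The approximation averages the values of \<open>f\<close> with a partition of unity subordinate to balls
  \<open>B(p, r p)\<close> on which \<open>f\<close> stays within \<open>\<epsilon>\<close> of \<open>f p\<close>. The whole vector of weights is
  locally Lipschitz in the \<open>\<ell>\<^sup>1\<close> norm (lemma \<open>locally_Lipschitz_partition_of_unity\<close>), and the
  average inherits this because the values of \<open>f\<close> that enter it are locally bounded.
  To get such weights, well-order the points and let \<open>p\<close> be active at \<open>x\<close> only if its bump
  \<open>max 0 (r p - d x p)\<close> is more than twice the supremum of the earlier bumps at \<open>x\<close>. Along the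
  active points the bumps start with a positive one, more than double, and stay bounded; so they are
  finitely many, and their sum is at most twice the largest one. The excess of an active
  bump over twice that supremum is Lipschitz in \<open>x\<close>, but the number of active points may be
  locally unbounded, so that the excesses themselves may vary too much in total. Their squares do
  not: the variation of a square is at most proportional to the excess itself, and the sum of the
  excesses is bounded.

  Conversely, let \<open>\<sigma>\<close> be a Cauchy sequence without a limit. Its range is infinite and all subsets of
  the range are closed, so Urysohn's lemma provides a continuous function into \<open>[0, 1]\<close> that takes
  each of the values 0 and 1 at infinitely many terms. Composed with a path with distinct ends in the
  target space it stays continuous, and it is TB-regular because the path is compact.
  But a Cauchy-Lipschitz function maps \<open>\<sigma>\<close> to a Cauchy sequence, so a function that it
  approximates cannot keep oscillating along \<open>\<sigma>\<close> by the distance of the two ends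
  (lemma \<open>not_mcomplete_imp_not_CL_approximable\<close>). For Banach spaces inside a given type it is enough
  to have one nonzero Banach space there: the real line, transported along an injection.
\<close>

section \<open>Locally Lipschitz partitions of unity\<close>

text \<open>
  From the top, the elements are at most \<open>c\<close>, \<open>c / 2\<close>, \<open>c / 4\<close> and so on, so a geometric series
  bounds the sum. In the induction, the elements below the largest one are bounded by half of it.
\<close>

lemma sum_doubling_le:
  fixes B :: "real set"
  assumes "finite B" and "\<And>b. b \<in> B \<Longrightarrow> 0 < b"
    and "\<And>a b. \<lbrakk>a \<in> B; b \<in> B; a < b\<rbrakk> \<Longrightarrow> 2 * a \<le> b"
    and "\<And>b. b \<in> B \<Longrightarrow> b \<le> c" and "0 \<le> c"
  shows "\<Sum>B \<le> 2 * c"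
  using assms
proof (induction B arbitrary: c rule: finite_linorder_max_induct)
  case (insert b B)
  have "\<Sum>B \<le> 2 * (b / 2)"
    by (rule insert.IH) (use insert in \<open>auto simp: field_simps intro: less_imp_le\<close>)
  moreover have "\<Sum>(insert b B) = b + \<Sum>B"
    using insert.hyps by (subst sum.insert) auto
  ultimately show ?case
    using insert.prems(3)[of b] by simp
qed simp

lemma abs_diff_quotients_le:
  fixes a b m n :: real
  assumes "0 < m" "0 < n" "0 \<le> b"
  shows "\<bar>a / m - b / n\<bar> \<le> \<bar>a - b\<bar> / m + b / n * (\<bar>m - n\<bar> / m)"
proof -
  have "a / m - b / n = (a - b) / m + b / n * ((n - m) / m)"
    using assms by (simp add: divide_simps) (simp add: algebra_simps)
  then have "\<bar>a / m - b / n\<bar> \<le> \<bar>(a - b) / m\<bar> + \<bar>b / n * ((n - m) / m)\<bar>"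
    by (simp only: abs_triangle_ineq)
  also have "\<bar>(a - b) / m\<bar> = \<bar>a - b\<bar> / m"
    using assms by simp
  also have "\<bar>b / n * ((n - m) / m)\<bar> = b / n * (\<bar>m - n\<bar> / m)"
    using assms by (simp add: abs_mult abs_minus_commute)
  finally show ?thesis .
qed

text \<open>
  The cover consists of the balls \<open>B(p, r p)\<close>, indexed by their centres; the bound on the radii
  bounds the bumps, and with them the suprema and sums formed below. Well-foundedness of the order
  supplies the first centre whose bump is positive at a given point, and totality makes one of two
  active centres exceed twice the height of the other.
\<close>

locale well_ordered_ball_cover = Metric_space +
  fixes r :: "'a \<Rightarrow> real" and before :: "'a \<Rightarrow> 'a \<Rightarrow> bool"
  assumes radius_pos: "p \<in> M \<Longrightarrow> 0 < r p"
    and radius_le_1: "p \<in> M \<Longrightarrow> r p \<le> 1"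
    and before_wf: "wfp before"
    and before_total: "p \<noteq> q \<Longrightarrow> before p q \<or> before q p"
begin

definition height :: "'a \<Rightarrow> 'a \<Rightarrow> real"
  where "height p x = max 0 (r p - d x p)"

text \<open>
  The value 0 is inserted because \<open>p\<close> may be the first centre, and the supremum of the empty set
  of reals is unspecified.
\<close>

definition record_height :: "'a \<Rightarrow> 'a \<Rightarrow> real"
  where "record_height p x = Sup (insert 0 {height q x | q. q \<in> M \<and> before q p})"

definition excess :: "'a \<Rightarrow> 'a \<Rightarrow> real"
  where "excess p x = (if p \<in> M then max 0 (height p x - 2 * record_height p x) else 0)"

definition active :: "'a \<Rightarrow> 'a set"
  where "active x = {p. excess p x \<noteq> 0}"

definition mass :: "'a \<Rightarrow> real"
  where "mass x = (\<Sum>p\<in>active x. (excess p x)\<^sup>2)"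

lemma height_nonneg: "0 \<le> height p x"
  by (simp add: height_def)

lemma height_le_1: "p \<in> M \<Longrightarrow> height p x \<le> 1"
  unfolding height_def using radius_le_1[of p] nonneg[of x p] by linarith

lemma height_Lipschitz:
  assumes "p \<in> M" "x \<in> M" "y \<in> M"
  shows "height p x \<le> height p y + d x y"
  using triangle[of y x p] assms commute[of x y] nonneg[of x y] by (auto simp: height_def max_def)

lemma record_bdd: "bdd_above (insert 0 {height q x | q. q \<in> M \<and> before q p})"
  by (rule bdd_aboveI[of _ 1]) (auto intro: height_le_1)

lemma record_nonneg: "0 \<le> record_height p x"
  unfolding record_height_def by (rule cSup_upper[OF _ record_bdd]) simp

lemma height_le_record: "\<lbrakk>q \<in> M; before q p\<rbrakk> \<Longrightarrow> height q x \<le> record_height p x"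
  unfolding record_height_def by (rule cSup_upper[OF _ record_bdd]) auto

lemma record_Lipschitz:
  assumes "x \<in> M" "y \<in> M"
  shows "record_height p x \<le> record_height p y + d x y"
  unfolding record_height_def[of p x]
proof (rule cSup_least)
  fix t assume "t \<in> insert 0 {height q x | q. q \<in> M \<and> before q p}"
  then consider "t = 0" | q where "t = height q x" "q \<in> M" "before q p" by auto
  then show "t \<le> record_height p y + d x y"
  proof cases
    case 1
    then show ?thesis using record_nonneg nonneg by (simp add: add_nonneg_nonneg)
  next
    case 2
    then show ?thesis
      using height_Lipschitz[of q x y] height_le_record[of q p y] assms by simp
  qed
qed simp

lemma excess_nonneg: "0 \<le> excess p x"
  by (simp add: excess_def)

lemma excess_Lipschitz:
  assumes "x \<in> M" "y \<in> M"
  shows "\<bar>excess p x - excess p y\<bar> \<le> 3 * d x y"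
  using assms height_Lipschitz[of p x y] height_Lipschitz[of p y x]
    record_Lipschitz[of x y p] record_Lipschitz[of y x p] commute[of x y]
  by (auto simp: excess_def max_def)

lemma active_subset: "active x \<subseteq> M"
  by (auto simp: active_def excess_def)

lemma excess_le_height: "p \<in> M \<Longrightarrow> excess p x \<le> height p x"
  using record_nonneg[of p x] height_nonneg[of p x] by (auto simp: excess_def)

lemma active_imp_near: "p \<in> active x \<Longrightarrow> p \<in> M \<and> d x p < r p"
  using record_nonneg[of p x]
  by (auto simp: active_def excess_def height_def max_def split: if_splits)

lemma active_doubling:
  assumes "p \<in> active x" "q \<in> active x" "before q p"
  shows "2 * height q x < height p x"
proof -
  have "q \<in> M" using assms active_subset by auto
  with assms show ?thesis
    using height_le_record[of q p x]
    by (auto simp: active_def excess_def max_def split: if_splits)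
qed

lemma active_height_pos: "p \<in> active x \<Longrightarrow> 0 < height p x"
  using active_imp_near by (auto simp: height_def)

text \<open>
  Of two active centres, the later one has more than twice the height of the earlier one. The
  heights of active centres are thus pairwise distinct, in \<open>(0, 1]\<close>, and with the gaps
  required for the doubling bound.
\<close>

lemma sum_height_le:
  assumes "finite A" "A \<subseteq> active x"
  shows "(\<Sum>p\<in>A. height p x) \<le> 2"
proof -
  have gap: "2 * height p x < height q x \<or> 2 * height q x < height p x"
    if "p \<in> A" "q \<in> A" "p \<noteq> q" for p q
    using before_total[OF \<open>p \<noteq> q\<close>] that assms active_doubling by blast
  have inj: "inj_on (\<lambda>p. height p x) A"
  proof (rule inj_onI, rule ccontr)
    fix p q assume "p \<in> A" "q \<in> A" "height p x = height q x" "p \<noteq> q"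
    then show False
      using gap[of p q] height_nonneg[of p x] by simp
  qed
  have "\<Sum>((\<lambda>p. height p x) ` A) \<le> 2 * 1"
  proof (rule sum_doubling_le)
    fix a b assume "a \<in> (\<lambda>p. height p x) ` A" "b \<in> (\<lambda>p. height p x) ` A" "a < b"
    then obtain p q where "p \<in> A" "q \<in> A" "a = height p x" "b = height q x" by auto
    then show "2 * a \<le> b"
      using gap[of p q] \<open>a < b\<close> height_nonneg[of q x] by (cases "p = q") auto
  qed (use assms active_height_pos height_le_1 active_subset[of x] in auto)
  then show ?thesis
    by (simp add: sum.reindex[OF inj])
qed

text \<open>
  Before the first centre with a positive bump there is nothing to exceed, so this centre is active,
  and by doubling it is the lowest of all active centres.
\<close>

lemma first_active:
  assumes "x \<in> M"
  obtains p where "p \<in> active x" and "\<And>q. q \<in> active x \<Longrightarrow> height p x \<le> height q x"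
proof -
  have "height x x > 0"
    using assms radius_pos by (simp add: height_def)
  then obtain p where p: "p \<in> M" "height p x > 0"
    and first: "\<And>q. before q p \<Longrightarrow> \<not> (q \<in> M \<and> height q x > 0)"
    using wfp_eq_minimal[THEN iffD1, OF before_wf, rule_format, of x "{p \<in> M. height p x > 0}"] assms
    by auto
  have "record_height p x \<le> 0"
    unfolding record_height_def
    by (rule cSup_least) (use first height_nonneg in \<open>force simp: not_less\<close>)+
  then have "excess p x = height p x"
    using record_nonneg[of p x] p by (simp add: excess_def)
  then have "p \<in> active x"
    using p by (simp add: active_def)
  moreover have "height p x \<le> height q x" if "q \<in> active x" for q
  proof (cases "q = p")
    case False
    moreover have "\<not> before q p"
      using first active_height_pos[OF that] active_subset that by auto
    ultimately have "before p q" using before_total by blast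
    from active_doubling[OF that \<open>p \<in> active x\<close> this] show ?thesis
      using height_nonneg[of p x] by simp
  qed simp
  ultimately show ?thesis by (rule that)
qed

text \<open>
  All active heights are at least that of the first active centre, and their sums are bounded.
\<close>

lemma finite_active:
  assumes "x \<in> M"
  shows "finite (active x)"
proof -
  obtain p where p: "p \<in> active x" and least: "\<And>q. q \<in> active x \<Longrightarrow> height p x \<le> height q x"
    using first_active[OF assms] by blast
  have pos: "0 < height p x" using active_height_pos[OF p] .
  have "card A \<le> nat \<lceil>2 / height p x\<rceil>" if "A \<subseteq> active x" "finite A" for A
  proof -
    have "real (card A) * height p x \<le> (\<Sum>q\<in>A. height q x)"
      using least that by (intro sum_bounded_below) auto
    also have "\<dots> \<le> 2" using that by (intro sum_height_le)
    finally have "real (card A) \<le> 2 / height p x"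
      using pos by (simp add: field_simps)
    then show ?thesis by linarith
  qed
  from finite_if_finite_subsets_card_bdd[OF this] show ?thesis by blast
qed

lemma sum_excess_le:
  assumes "x \<in> M" "finite A"
  shows "(\<Sum>p\<in>A. excess p x) \<le> 2"
proof -
  have "(\<Sum>p\<in>A. excess p x) = (\<Sum>p\<in>A \<inter> active x. excess p x)"
    using assms by (intro sum.mono_neutral_right) (auto simp: active_def)
  also have "\<dots> \<le> (\<Sum>p\<in>A \<inter> active x. height p x)"
    using active_subset by (intro sum_mono excess_le_height) auto
  also have "\<dots> \<le> 2"
    using assms by (intro sum_height_le) auto
  finally show ?thesis .
qed

text \<open>
  This is where squaring pays off: \<open>\<bar>a\<^sup>2 - b\<^sup>2\<bar> = \<bar>a - b\<bar> * (a + b)\<close>, where the first factor is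
  at most \<open>3 * d x y\<close> and the sum of the second one is at most 4, whatever the size of \<open>A\<close>.
\<close>

lemma sum_square_excess_Lipschitz:
  assumes "x \<in> M" "y \<in> M" "finite A"
  shows "(\<Sum>p\<in>A. \<bar>(excess p x)\<^sup>2 - (excess p y)\<^sup>2\<bar>) \<le> 12 * d x y"
proof -
  have "\<bar>(excess p x)\<^sup>2 - (excess p y)\<^sup>2\<bar> \<le> 3 * d x y * (excess p x + excess p y)" for p
  proof -
    have "\<bar>(excess p x)\<^sup>2 - (excess p y)\<^sup>2\<bar>
        = \<bar>excess p x - excess p y\<bar> * (excess p x + excess p y)"
      using excess_nonneg[of p x] excess_nonneg[of p y]
      by (simp add: power2_eq_square square_diff_square_factored abs_mult mult.commute)
    also have "\<dots> \<le> 3 * d x y * (excess p x + excess p y)"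
      using assms by (intro mult_right_mono excess_Lipschitz add_nonneg_nonneg excess_nonneg)
    finally show ?thesis .
  qed
  then have "(\<Sum>p\<in>A. \<bar>(excess p x)\<^sup>2 - (excess p y)\<^sup>2\<bar>)
      \<le> (\<Sum>p\<in>A. 3 * d x y * (excess p x + excess p y))"
    by (intro sum_mono)
  also have "\<dots> = 3 * d x y * ((\<Sum>p\<in>A. excess p x) + (\<Sum>p\<in>A. excess p y))"
    by (simp only: sum_distrib_left[symmetric] sum.distrib)
  also have "\<dots> \<le> 3 * d x y * (2 + 2)"
    using assms nonneg by (intro mult_left_mono add_mono sum_excess_le) auto
  finally show ?thesis by simp
qed

lemma mass_pos: "x \<in> M \<Longrightarrow> 0 < mass x"
  unfolding mass_def
proof (rule sum_pos)
  assume x: "x \<in> M"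
  show "finite (active x)" by (rule finite_active[OF x])
  show "active x \<noteq> {}" using first_active[OF x] by blast
qed (auto simp: active_def)

lemma mass_superset:
  assumes "finite A" "active x \<subseteq> A"
  shows "mass x = (\<Sum>p\<in>A. (excess p x)\<^sup>2)"
  unfolding mass_def using assms by (intro sum.mono_neutral_left) (auto simp: active_def)

lemma mass_Lipschitz:
  assumes "x \<in> M" "y \<in> M"
  shows "\<bar>mass x - mass y\<bar> \<le> 12 * d x y"
proof -
  let ?A = "active x \<union> active y"
  have fin: "finite ?A" using assms finite_active by auto
  have "\<bar>mass x - mass y\<bar> = \<bar>\<Sum>p\<in>?A. (excess p x)\<^sup>2 - (excess p y)\<^sup>2\<bar>"
    using fin by (simp add: mass_superset[of ?A] sum_subtractf)
  also have "\<dots> \<le> (\<Sum>p\<in>?A. \<bar>(excess p x)\<^sup>2 - (excess p y)\<^sup>2\<bar>)" by (rule sum_abs)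
  also have "\<dots> \<le> 12 * d x y" by (rule sum_square_excess_Lipschitz[OF assms fin])
  finally show ?thesis .
qed

text \<open>
  The Lipschitz constant at \<open>x\<close> depends on \<open>x\<close> only through the total mass,
  which is continuous and positive and therefore locally bounded away from 0.
\<close>

lemma weights_Lipschitz:
  assumes "x \<in> M" "y \<in> M" "finite A"
  shows "(\<Sum>p\<in>A. \<bar>(excess p x)\<^sup>2 / mass x - (excess p y)\<^sup>2 / mass y\<bar>) \<le> 24 / mass x * d x y"
proof -
  note pos = mass_pos[OF assms(1)] mass_pos[OF assms(2)]
  have "\<bar>(excess p x)\<^sup>2 / mass x - (excess p y)\<^sup>2 / mass y\<bar>
      \<le> \<bar>(excess p x)\<^sup>2 - (excess p y)\<^sup>2\<bar> / mass x
        + (excess p y)\<^sup>2 / mass y * (\<bar>mass x - mass y\<bar> / mass x)" for p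
    using pos by (intro abs_diff_quotients_le) auto
  then have "(\<Sum>p\<in>A. \<bar>(excess p x)\<^sup>2 / mass x - (excess p y)\<^sup>2 / mass y\<bar>)
      \<le> (\<Sum>p\<in>A. \<bar>(excess p x)\<^sup>2 - (excess p y)\<^sup>2\<bar> / mass x
        + (excess p y)\<^sup>2 / mass y * (\<bar>mass x - mass y\<bar> / mass x))"
    by (intro sum_mono)
  also have "\<dots> = (\<Sum>p\<in>A. \<bar>(excess p x)\<^sup>2 - (excess p y)\<^sup>2\<bar>) / mass x
      + (\<Sum>p\<in>A. (excess p y)\<^sup>2) / mass y * (\<bar>mass x - mass y\<bar> / mass x)"
    by (simp only: sum.distrib sum_divide_distrib[symmetric] sum_distrib_right[symmetric])
  also have "\<dots> \<le> 12 * d x y / mass x + 1 * (12 * d x y / mass x)"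
  proof (rule add_mono)
    show "(\<Sum>p\<in>A. \<bar>(excess p x)\<^sup>2 - (excess p y)\<^sup>2\<bar>) / mass x \<le> 12 * d x y / mass x"
      by (rule divide_right_mono[OF sum_square_excess_Lipschitz[OF assms]]) (use pos in simp)
    have "(\<Sum>p\<in>A. (excess p y)\<^sup>2) \<le> (\<Sum>p\<in>A \<union> active y. (excess p y)\<^sup>2)"
      using assms finite_active by (intro sum_mono2) auto
    also have "\<dots> = mass y"
      using assms finite_active by (intro mass_superset[symmetric]) auto
    finally have "(\<Sum>p\<in>A. (excess p y)\<^sup>2) / mass y \<le> 1"
      using pos by simp
    moreover have "\<bar>mass x - mass y\<bar> / mass x \<le> 12 * d x y / mass x"
      by (rule divide_right_mono[OF mass_Lipschitz[OF assms(1,2)]]) (use pos in simp)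
    ultimately show "(\<Sum>p\<in>A. (excess p y)\<^sup>2) / mass y * (\<bar>mass x - mass y\<bar> / mass x)
        \<le> 1 * (12 * d x y / mass x)"
      by (rule mult_mono) (use pos in simp_all)
  qed
  finally show ?thesis by simp
qed

end

text \<open>
  The last property bounds the \<open>\<ell>\<^sup>1\<close> distance of the weight vectors at \<open>x\<close> and \<open>y\<close>, which is
  what averages of vectors of bounded norm require. It is stated for all finite sets of indices
  because the supports at \<open>x\<close> and \<open>y\<close> vary with the points.
\<close>

lemma (in Metric_space) locally_Lipschitz_partition_of_unity:
  fixes r :: "'a \<Rightarrow> real"
  assumes r: "\<And>p. p \<in> M \<Longrightarrow> 0 < r p"
  obtains w :: "'a \<Rightarrow> 'a \<Rightarrow> real"
  where "\<And>p x. 0 \<le> w p x"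
    and "\<And>p x. w p x \<noteq> 0 \<Longrightarrow> p \<in> M \<and> d x p < r p"
    and "\<And>x. x \<in> M \<Longrightarrow> finite {p. w p x \<noteq> 0}"
    and "\<And>x. x \<in> M \<Longrightarrow> (\<Sum>p | w p x \<noteq> 0. w p x) = 1"
    and "\<And>z. z \<in> M \<Longrightarrow> \<exists>\<delta>>0. \<exists>L. \<forall>x\<in>mball z \<delta>. \<forall>y\<in>mball z \<delta>.
           \<forall>A. finite A \<longrightarrow> (\<Sum>p\<in>A. \<bar>w p x - w p y\<bar>) \<le> L * d x y"
proof -
  obtain R :: "'a rel" where "Well_order R \<and> Field R = UNIV"
    using well_ordering ..
  then have R: "Well_order R" "Field R = UNIV"
    by (rule conjunct1, rule conjunct2)
  have wo: "wf (R - Id)" "total R"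
    using R by (auto simp: well_order_on_def linear_order_on_def)
  define before where "before p q \<longleftrightarrow> (p, q) \<in> R - Id" for p q
  interpret well_ordered_ball_cover M d "\<lambda>p. min 1 (r p)" before
  proof
    have "{(p, q). before p q} = R - Id"
      unfolding before_def by auto
    then show "wfp before"
      using wo(1) by (simp only: wfp_def)
    show "before p q \<or> before q p" if "p \<noteq> q" for p q
      using wo(2) that by (auto simp: before_def total_on_def R(2))
  qed (use r in auto)
  define w where "w p x = (if x \<in> M then (excess p x)\<^sup>2 / mass x else 0)" for p x
  have supp: "{p. w p x \<noteq> 0} = active x" if "x \<in> M" for x
    using that mass_pos[OF that] by (auto simp: w_def active_def)
  show ?thesis
  proof (rule that[of w])
    show "0 \<le> w p x" for p x
      using mass_pos[of x] by (auto simp: w_def intro: less_imp_le)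
    show "p \<in> M \<and> d x p < r p" if "w p x \<noteq> 0" for p x
      using that supp[of x] active_imp_near[of p x] by (auto simp: w_def split: if_splits)
    show "finite {p. w p x \<noteq> 0}" if "x \<in> M" for x
      by (simp add: supp[OF that] finite_active[OF that])
    show "(\<Sum>p | w p x \<noteq> 0. w p x) = 1" if "x \<in> M" for x
      unfolding supp[OF that] using that mass_pos[OF that]
      by (simp add: w_def sum_divide_distrib[symmetric] mass_def[symmetric])
    fix z assume z: "z \<in> M"
    \<comment> \<open>The mass is Lipschitz with constant 12, so on this ball it is at least half of its value at \<open>z\<close>.\<close>
    define \<delta> where "\<delta> = mass z / 24"
    have m: "mass z > 0" by (rule mass_pos[OF z])
    have "(\<Sum>p\<in>A. \<bar>w p x - w p y\<bar>) \<le> 48 / mass z * d x y"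
      if "x \<in> mball z \<delta>" "y \<in> mball z \<delta>" "finite A" for x y A
    proof -
      have xy: "x \<in> M" "y \<in> M" "d z x < \<delta>" using that by auto
      have "mass z / 2 \<le> mass x"
        using mass_Lipschitz[OF z xy(1)] xy(3) by (auto simp: \<delta>_def)
      then have "24 / mass x \<le> 24 / (mass z / 2)"
        using m by (intro divide_left_mono) auto
      then have "24 / mass x * d x y \<le> 48 / mass z * d x y"
        by (intro mult_right_mono) auto
      with weights_Lipschitz[OF xy(1,2) that(3)] show ?thesis
        by (simp add: w_def xy)
    qed
    then show "\<exists>\<delta>>0. \<exists>L. \<forall>x\<in>mball z \<delta>. \<forall>y\<in>mball z \<delta>.
           \<forall>A. finite A \<longrightarrow> (\<Sum>p\<in>A. \<bar>w p x - w p y\<bar>) \<le> L * d x y"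
      using m by (intro exI[of _ \<delta>] conjI exI[of _ "48 / mass z"]) (auto simp: \<delta>_def)
  qed
qed

section \<open>Linear combinations in normed spaces with explicit carrier\<close>

context real_normed_space
begin

lemma smult_in_carrier [simp]: "x \<in> carrier V \<Longrightarrow> a \<odot> x \<in> carrier V"
  by (rule smult_closed) (simp_all add: ring_of_type_algebra_def)

lemma smult_add_left: "x \<in> carrier V \<Longrightarrow> (a + b) \<odot> x = a \<odot> x \<oplus> b \<odot> x"
  using smult_l_distr[of a b x] by (simp add: ring_of_type_algebra_def)

lemma smult_zero_left: "x \<in> carrier V \<Longrightarrow> 0 \<odot> x = \<zero>"
  using smult_l_null[of x] by (simp add: ring_of_type_algebra_def)

lemma smult_one_left: "x \<in> carrier V \<Longrightarrow> 1 \<odot> x = x"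
  using smult_one[of x] by (simp add: ring_of_type_algebra_def)

lemma smult_diff_left:
  assumes "x \<in> carrier V"
  shows "(a - b) \<odot> x = a \<odot> x \<ominus> b \<odot> x"
proof -
  have "a \<odot> x = (a - b) \<odot> x \<oplus> b \<odot> x"
    using smult_add_left[OF assms, of "a - b" b] by simp
  then show ?thesis
    using assms by (simp add: a_minus_def M.a_assoc M.r_neg)
qed

lemma smult_diff_right:
  assumes "x \<in> carrier V" "y \<in> carrier V"
  shows "a \<odot> (x \<ominus> y) = a \<odot> x \<ominus> a \<odot> y"
proof -
  have "a \<odot> x = a \<odot> (x \<ominus> y \<oplus> y)"
    using assms by (simp add: a_minus_def M.a_assoc M.l_neg)
  also have "\<dots> = a \<odot> (x \<ominus> y) \<oplus> a \<odot> y"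
    using assms by (intro smult_r_distr) (auto simp: ring_of_type_algebra_def)
  finally show ?thesis
    using assms by (simp add: a_minus_def M.a_assoc M.r_neg)
qed

lemma add_minus_add:
  assumes "a \<in> carrier V" "b \<in> carrier V" "c \<in> carrier V" "e \<in> carrier V"
  shows "(a \<oplus> b) \<ominus> (c \<oplus> e) = (a \<ominus> c) \<oplus> (b \<ominus> e)"
  using assms by (simp add: a_minus_def M.minus_add M.a_ac)

lemma finsum_in_carrier [simp]:
  "v \<in> A \<rightarrow> carrier V \<Longrightarrow> (\<Oplus>\<^bsub>V\<^esub>i\<in>A. a i \<odot> v i) \<in> carrier V"
  by (rule M.finsum_closed) (auto simp: Pi_iff)

lemma finsum_smult_diff:
  assumes "finite A" "v \<in> A \<rightarrow> carrier V"
  shows "(\<Oplus>\<^bsub>V\<^esub>i\<in>A. a i \<odot> v i) \<ominus> (\<Oplus>\<^bsub>V\<^esub>i\<in>A. b i \<odot> v i) = (\<Oplus>\<^bsub>V\<^esub>i\<in>A. (a i - b i) \<odot> v i)"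
  using assms
proof (induction A rule: finite_induct)
  case empty
  then show ?case by (simp add: a_minus_def)
next
  case (insert j A)
  then have v: "v j \<in> carrier V" "v \<in> A \<rightarrow> carrier V" by auto
  have "(\<Oplus>\<^bsub>V\<^esub>i\<in>insert j A. c i \<odot> v i) = c j \<odot> v j \<oplus> (\<Oplus>\<^bsub>V\<^esub>i\<in>A. c i \<odot> v i)" for c
    using insert.hyps v by (intro M.finsum_insert) (auto simp: Pi_iff)
  then show ?case
    using v insert.IH[OF v(2)] by (simp add: add_minus_add smult_diff_left)
qed

lemma finsum_smult_shift:
  assumes "finite A" "v \<in> A \<rightarrow> carrier V" "c \<in> carrier V"
  shows "(\<Oplus>\<^bsub>V\<^esub>i\<in>A. a i \<odot> v i) \<ominus> (\<Sum>i\<in>A. a i) \<odot> c = (\<Oplus>\<^bsub>V\<^esub>i\<in>A. a i \<odot> (v i \<ominus> c))"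
  using assms(1,2)
proof (induction A rule: finite_induct)
  case empty
  then show ?case using assms(3) by (simp add: a_minus_def smult_zero_left)
next
  case (insert j A)
  then have v: "v j \<in> carrier V" "v \<in> A \<rightarrow> carrier V" by auto
  have v': "(\<lambda>i. v i \<ominus> c) \<in> A \<rightarrow> carrier V" using v assms(3) by (auto simp: Pi_iff)
  have "(\<Oplus>\<^bsub>V\<^esub>i\<in>insert j A. a i \<odot> v i) = a j \<odot> v j \<oplus> (\<Oplus>\<^bsub>V\<^esub>i\<in>A. a i \<odot> v i)"
    using insert.hyps v by (intro M.finsum_insert) (auto simp: Pi_iff)
  moreover have "(\<Oplus>\<^bsub>V\<^esub>i\<in>insert j A. a i \<odot> (v i \<ominus> c))
      = a j \<odot> (v j \<ominus> c) \<oplus> (\<Oplus>\<^bsub>V\<^esub>i\<in>A. a i \<odot> (v i \<ominus> c))"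
    using insert.hyps v v' assms(3) by (intro M.finsum_insert) (auto simp: Pi_iff)
  ultimately show ?case
    using v insert.IH[OF v(2)] insert.hyps assms(3)
    by (simp add: smult_add_left add_minus_add smult_diff_right)
qed

lemma nrm_finsum_smult_le:
  assumes "finite A" "v \<in> A \<rightarrow> carrier V"
  shows "nrm V (\<Oplus>\<^bsub>V\<^esub>i\<in>A. a i \<odot> v i) \<le> (\<Sum>i\<in>A. \<bar>a i\<bar> * nrm V (v i))"
  using assms
proof (induction A rule: finite_induct)
  case empty
  then show ?case using nrm_eq_zero[of "\<zero>"] by simp
next
  case (insert j A)
  then have v: "v j \<in> carrier V" "v \<in> A \<rightarrow> carrier V" by auto
  have "(\<Oplus>\<^bsub>V\<^esub>i\<in>insert j A. a i \<odot> v i) = a j \<odot> v j \<oplus> (\<Oplus>\<^bsub>V\<^esub>i\<in>A. a i \<odot> v i)"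
    using insert.hyps v by (intro M.finsum_insert) (auto simp: Pi_iff)
  then show ?case
    using nrm_triangle[of "a j \<odot> v j" "\<Oplus>\<^bsub>V\<^esub>i\<in>A. a i \<odot> v i"] v insert.IH[OF v(2)] insert.hyps
    by (simp add: nrm_smult)
qed

text \<open>
  With total weight 1 this bounds the distance of an average to \<open>c\<close>. The last hypothesis is
  restricted to nonzero weights because a partition of unity controls the values of a function only
  at the centres that are active.
\<close>

lemma nrm_combination_minus_le:
  assumes "finite A" "v \<in> A \<rightarrow> carrier V" "c \<in> carrier V"
    and "\<And>i. \<lbrakk>i \<in> A; a i \<noteq> 0\<rbrakk> \<Longrightarrow> nrm V (v i \<ominus> c) \<le> e"
  shows "nrm V ((\<Oplus>\<^bsub>V\<^esub>i\<in>A. a i \<odot> v i) \<ominus> (\<Sum>i\<in>A. a i) \<odot> c) \<le> (\<Sum>i\<in>A. \<bar>a i\<bar>) * e"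
proof -
  have "nrm V (\<Oplus>\<^bsub>V\<^esub>i\<in>A. a i \<odot> (v i \<ominus> c)) \<le> (\<Sum>i\<in>A. \<bar>a i\<bar> * nrm V (v i \<ominus> c))"
    using assms(1-3) by (intro nrm_finsum_smult_le) (auto simp: Pi_iff)
  also have "\<dots> \<le> (\<Sum>i\<in>A. \<bar>a i\<bar> * e)"
  proof (rule sum_mono)
    fix i assume "i \<in> A"
    then show "\<bar>a i\<bar> * nrm V (v i \<ominus> c) \<le> \<bar>a i\<bar> * e"
      using assms(4)[of i] by (cases "a i = 0") (auto intro: mult_left_mono)
  qed
  finally show ?thesis
    by (simp add: finsum_smult_shift[OF assms(1-3)] sum_distrib_right)
qed

text \<open>
  The difference of two combinations of equal total weight does not change when all vectors are
  translated by \<open>-c\<close>. So the norms that matter are those of \<open>v i - c\<close>, which are small where those of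
  \<open>v i\<close> may be large.
\<close>

lemma nrm_combination_diff_le:
  assumes "finite A" "v \<in> A \<rightarrow> carrier V" "c \<in> carrier V"
    and "(\<Sum>i\<in>A. a i) = (\<Sum>i\<in>A. b i)"
    and "\<And>i. \<lbrakk>i \<in> A; a i \<noteq> b i\<rbrakk> \<Longrightarrow> nrm V (v i \<ominus> c) \<le> e"
  shows "nrm V ((\<Oplus>\<^bsub>V\<^esub>i\<in>A. a i \<odot> v i) \<ominus> (\<Oplus>\<^bsub>V\<^esub>i\<in>A. b i \<odot> v i)) \<le> (\<Sum>i\<in>A. \<bar>a i - b i\<bar>) * e"
proof -
  let ?s = "\<Oplus>\<^bsub>V\<^esub>i\<in>A. (a i - b i) \<odot> v i"
  have "(\<Sum>i\<in>A. a i - b i) = 0" using assms(4) by (simp add: sum_subtractf)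
  then have "?s \<ominus> (\<Sum>i\<in>A. a i - b i) \<odot> c = ?s"
    using assms by (simp add: smult_zero_left a_minus_def)
  moreover have "nrm V (?s \<ominus> (\<Sum>i\<in>A. a i - b i) \<odot> c) \<le> (\<Sum>i\<in>A. \<bar>a i - b i\<bar>) * e"
    using assms by (intro nrm_combination_minus_le) auto
  ultimately show ?thesis
    by (simp add: finsum_smult_diff[OF assms(1,2)])
qed

end

section \<open>Approximation by Cauchy-Lipschitz functions on complete spaces\<close>

text \<open>
  A new point outside a closed set \<open>C\<close> has a distance at least \<open>\<eta> > 0\<close> to all points of
  \<open>C\<close>. Comparison through a fixed point \<open>c\<close> of \<open>C\<close> bounds the distance of the values by
  a constant plus \<open>L\<close> times the distance of the points, and the constant is absorbed by \<open>\<eta>\<close>.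
\<close>

lemma Lipschitz_continuous_map_insert:
  assumes "closedin (mtopology_of m1) C"
    and "Lipschitz_continuous_map (submetric m1 C) m2 g"
    and "p \<in> mspace m1" "g p \<in> mspace m2"
  shows "Lipschitz_continuous_map (submetric m1 (insert p C)) m2 g"
proof -
  interpret A: Metric_space "mspace m1" "mdist m1" by simp
  interpret B: Metric_space "mspace m2" "mdist m2" by simp
  show ?thesis
  proof (cases "p \<in> C \<or> C = {}")
    case True
    then show ?thesis
    proof
      assume "p \<in> C"
      then show ?thesis using assms(2) by (simp add: insert_absorb)
    next
      assume "C = {}"
      then show ?thesis
        using assms(3,4) by (auto simp: Lipschitz_continuous_map_def)
    qed
  next
    case False
    have C: "C \<subseteq> mspace m1"
      using closedin_subset[OF assms(1)] by simp
    obtain c where c: "c \<in> C" using False by auto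
    obtain L where "L > 0" and L: "\<And>x y. \<lbrakk>x \<in> C; y \<in> C\<rbrakk> \<Longrightarrow> mdist m2 (g x) (g y) \<le> L * mdist m1 x y"
      using assms(2) C unfolding Lipschitz_continuous_map_pos by (auto simp: Int_absorb2)
    have g: "g x \<in> mspace m2" if "x \<in> C" for x
      using assms(2) C that by (auto simp: Lipschitz_continuous_map_def)
    obtain \<eta> where "\<eta> > 0" and \<eta>: "disjnt C (A.mball p \<eta>)"
      using assms(1,3) False unfolding mtopology_of_def A.closedin_metric by auto
    have far: "\<eta> \<le> mdist m1 p y" if "y \<in> C" for y
      using \<eta> that C assms(3) by (auto simp: disjnt_iff not_less)
    define K where "K = mdist m2 (g p) (g c) + L * mdist m1 c p"
    have "K \<ge> 0" using \<open>L > 0\<close> by (simp add: K_def)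
    have new: "mdist m2 (g p) (g y) \<le> (K / \<eta> + L) * mdist m1 p y" if y: "y \<in> C" for y
    proof -
      have "mdist m2 (g p) (g y) \<le> mdist m2 (g p) (g c) + mdist m2 (g c) (g y)"
        using B.triangle assms(4) g c y by blast
      also have "mdist m2 (g c) (g y) \<le> L * mdist m1 c y"
        using L c y by blast
      also have "\<dots> \<le> L * (mdist m1 c p + mdist m1 p y)"
        using A.triangle[of c p y] c y C assms(3) \<open>L > 0\<close> by (intro mult_left_mono) auto
      finally have "mdist m2 (g p) (g y) \<le> K + L * mdist m1 p y"
        by (simp add: K_def distrib_left)
      moreover have "K / \<eta> * \<eta> \<le> K / \<eta> * mdist m1 p y"
        using far[OF y] \<open>K \<ge> 0\<close> \<open>\<eta> > 0\<close> by (intro mult_left_mono) auto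
      ultimately show ?thesis
        using \<open>\<eta> > 0\<close> by (simp add: distrib_right)
    qed
    have "mdist m2 (g x) (g y) \<le> (K / \<eta> + L) * mdist m1 x y"
      if xy: "x \<in> insert p C" "y \<in> insert p C" for x y
    proof -
      consider "x = p" "y = p" | "x = p" "y \<in> C" | "x \<in> C" "y = p" | "x \<in> C" "y \<in> C"
        using xy by blast
      then show ?thesis
      proof cases
        case 1
        then show ?thesis using assms(3,4) by simp
      next
        case 2
        then show ?thesis using new by simp
      next
        case 3
        then show ?thesis using new[of x] by (simp add: mdist_commute)
      next
        case 4
        have "L * mdist m1 x y \<le> (K / \<eta> + L) * mdist m1 x y"
          using \<open>K \<ge> 0\<close> \<open>\<eta> > 0\<close> by (intro mult_right_mono) auto
        with L[OF 4] show ?thesis by simp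
      qed
    qed
    then show ?thesis
      using g assms(4) unfolding Lipschitz_continuous_map_def by auto
  qed
qed

text \<open>
  Closedness is part of the conclusion because the induction adds the points one by one, and each
  step requires a closed set.
\<close>

lemma Lipschitz_continuous_map_Un_finite:
  assumes "finite F" "F \<subseteq> mspace m1" "closedin (mtopology_of m1) C"
    and "Lipschitz_continuous_map (submetric m1 C) m2 g" "g \<in> F \<rightarrow> mspace m2"
  shows "closedin (mtopology_of m1) (F \<union> C) \<and> Lipschitz_continuous_map (submetric m1 (F \<union> C)) m2 g"
  using assms(1,2,5)
proof (induction F rule: finite_induct)
  case empty
  then show ?case using assms by simp
next
  case (insert p F)
  interpret A: Metric_space "mspace m1" "mdist m1" by simp
  have IH: "closedin (mtopology_of m1) (F \<union> C)" "Lipschitz_continuous_map (submetric m1 (F \<union> C)) m2 g"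
    using insert by auto
  have "closedin (mtopology_of m1) {p}"
    using insert.prems A.Hausdorff_space_mtopology
    by (simp add: mtopology_of_def closedin_Hausdorff_singleton)
  then have "closedin (mtopology_of m1) ({p} \<union> (F \<union> C))"
    using IH(1) by (rule closedin_Un)
  moreover have "Lipschitz_continuous_map (submetric m1 (insert p (F \<union> C))) m2 g"
    using insert.prems IH by (intro Lipschitz_continuous_map_insert) auto
  ultimately show ?case by simp
qed

lemma locally_Lipschitz_imp_Cauchy_Lipschitz:
  assumes "mcomplete_of m1" "g \<in> mspace m1 \<rightarrow> mspace m2"
    and loc: "\<And>z. z \<in> mspace m1 \<Longrightarrow> \<exists>\<delta>>0.
           Lipschitz_continuous_map (submetric m1 (Metric_space.mball (mspace m1) (mdist m1) z \<delta>)) m2 g"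
  shows "Cauchy_Lipschitz m1 m2 g"
  unfolding Cauchy_Lipschitz_def
proof (intro conjI allI impI)
  interpret A: Metric_space "mspace m1" "mdist m1" by simp
  fix \<sigma> assume \<sigma>: "A.MCauchy \<sigma>"
  then have ran: "range \<sigma> \<subseteq> mspace m1" by (simp add: A.MCauchy_def)
  obtain z where z: "limitin A.mtopology \<sigma> z sequentially"
    using assms(1) \<sigma> by (auto simp: mcomplete_of_def A.mcomplete_def)
  then have zM: "z \<in> mspace m1" by (rule A.limitin_mspace)
  obtain \<delta> where "\<delta> > 0" and lip: "Lipschitz_continuous_map (submetric m1 (A.mball z \<delta>)) m2 g"
    using loc[OF zM] by blast
  define C where "C = A.mcball z (\<delta> / 2)"
  have "C \<subseteq> A.mball z \<delta>"
    using \<open>\<delta> > 0\<close> by (auto simp: C_def)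
  then have lipC: "Lipschitz_continuous_map (submetric m1 C) m2 g"
    using lip by (rule Lipschitz_continuous_map_from_submetric_mono[rotated])
  have closC: "closedin (mtopology_of m1) C"
    by (simp add: C_def mtopology_of_def)
  obtain N where N: "\<And>n. n \<ge> N \<Longrightarrow> \<sigma> n \<in> A.mball z (\<delta> / 2)"
    using z \<open>\<delta> > 0\<close> unfolding A.limitin_metric eventually_sequentially
    by (metis A.commute A.in_mball half_gt_zero)
  have "\<sigma> n \<in> \<sigma> ` {..<N} \<union> C" for n
    using N[of n] by (cases "n < N") (auto simp: C_def)
  then have "range \<sigma> \<subseteq> \<sigma> ` {..<N} \<union> C" by blast
  moreover have "Lipschitz_continuous_map (submetric m1 (\<sigma> ` {..<N} \<union> C)) m2 g"
    using Lipschitz_continuous_map_Un_finite[OF _ _ closC lipC, of "\<sigma> ` {..<N}"] ran assms(2)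
    by (auto simp: Pi_iff image_subset_iff)
  ultimately show "Lipschitz_continuous_map (submetric m1 (range \<sigma>)) m2 g"
    using Lipschitz_continuous_map_from_submetric_mono by blast
qed (rule assms(2))

text \<open>
  The approximation is the average of the values \<open>f p\<close> with a partition of unity whose weight at
  \<open>p\<close> vanishes outside a ball around \<open>p\<close> where \<open>f\<close> stays within \<open>\<epsilon>\<close> of
  \<open>f p\<close>. Near \<open>z\<close>, all values that enter the average lie within \<open>2 * \<epsilon>\<close> of
  \<open>f z\<close>, so the average inherits a local Lipschitz constant from the weights.
\<close>

lemma (in real_normed_space) locally_Lipschitz_approximation:
  fixes m :: "'b metric"
  assumes f: "continuous_map (mtopology_of m) (mtopology_of (norm_metric V)) f" and "0 < \<epsilon>"
  obtains g where "g \<in> mspace m \<rightarrow> carrier V"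
    and "\<And>x. x \<in> mspace m \<Longrightarrow> mdist (norm_metric V) (f x) (g x) \<le> \<epsilon>"
    and "\<And>z. z \<in> mspace m \<Longrightarrow> \<exists>\<delta>>0. Lipschitz_continuous_map
           (submetric m (Metric_space.mball (mspace m) (mdist m) z \<delta>)) (norm_metric V) g"
proof -
  interpret A: Metric_space "mspace m" "mdist m" by simp
  interpret B: Metric_space "carrier V" "mdist (norm_metric V)"
    using Metric_space_mspace_mdist[of "norm_metric V"] by simp
  have fV: "f x \<in> carrier V" if "x \<in> mspace m" for x
    using continuous_map_image_subset_topspace[OF f] that by auto
  have "\<exists>\<rho>>0. \<forall>x\<in>mspace m. mdist m p x < \<rho> \<longrightarrow> mdist (norm_metric V) (f p) (f x) < \<epsilon>"
    if "p \<in> mspace m" for p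
  proof -
    have "continuous_map A.mtopology B.mtopology f"
      using f by (simp add: mtopology_of_def)
    then show ?thesis
      using that \<open>0 < \<epsilon>\<close> B.commute fV unfolding A.metric_continuous_map[OF B.Metric_space_axioms] by metis
  qed
  then obtain r where r_pos: "\<And>p. p \<in> mspace m \<Longrightarrow> 0 < r p"
    and r: "\<And>p x. \<lbrakk>p \<in> mspace m; x \<in> mspace m; mdist m p x < r p\<rbrakk>
              \<Longrightarrow> mdist (norm_metric V) (f p) (f x) < \<epsilon>"
    by metis
  obtain w :: "'b \<Rightarrow> 'b \<Rightarrow> real" where w_nonneg: "\<And>p x. 0 \<le> w p x"
    and w_near: "\<And>p x. w p x \<noteq> 0 \<Longrightarrow> p \<in> mspace m \<and> mdist m x p < r p"
    and w_finite: "\<And>x. x \<in> mspace m \<Longrightarrow> finite {p. w p x \<noteq> 0}"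
    and w_sum: "\<And>x. x \<in> mspace m \<Longrightarrow> (\<Sum>p | w p x \<noteq> 0. w p x) = 1"
    and w_lip: "\<And>z. z \<in> mspace m \<Longrightarrow> \<exists>\<delta>>0. \<exists>L. \<forall>x\<in>A.mball z \<delta>. \<forall>y\<in>A.mball z \<delta>.
           \<forall>S. finite S \<longrightarrow> (\<Sum>p\<in>S. \<bar>w p x - w p y\<bar>) \<le> L * mdist m x y"
    by (rule A.locally_Lipschitz_partition_of_unity[of r, OF r_pos]) blast+
  define g where "g x = (\<Oplus>\<^bsub>V\<^esub>p\<in>{p. w p x \<noteq> 0}. w p x \<odot> f p)" for x
  have fp: "f \<in> {p. w p x \<noteq> 0} \<rightarrow> carrier V" for x
    using fV w_near by auto
  have near: "nrm V (f p \<ominus> f x) < \<epsilon>" if "w p x \<noteq> 0" "x \<in> mspace m" for p x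
    using r[of p x] w_near[OF that(1)] that(2) fV by (simp add: mdist_commute mdist_norm_metric)
  have gV: "g x \<in> carrier V" for x
    unfolding g_def by (rule finsum_in_carrier[OF fp])
  show ?thesis
  proof (rule that[of g])
    show "g \<in> mspace m \<rightarrow> carrier V" using gV by auto
    fix x assume x: "x \<in> mspace m"
    have "nrm V (g x \<ominus> (\<Sum>p | w p x \<noteq> 0. w p x) \<odot> f x) \<le> (\<Sum>p | w p x \<noteq> 0. \<bar>w p x\<bar>) * \<epsilon>"
      unfolding g_def using near x
      by (intro nrm_combination_minus_le w_finite fp fV) (auto intro: less_imp_le)
    then show "mdist (norm_metric V) (f x) (g x) \<le> \<epsilon>"
      using x w_sum[OF x] w_nonneg
      by (subst mdist_commute) (simp add: mdist_norm_metric gV fV smult_one_left)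
  next
    fix z assume z: "z \<in> mspace m"
    obtain \<delta> L where "\<delta> > 0" and L: "\<And>x y S. \<lbrakk>x \<in> A.mball z \<delta>; y \<in> A.mball z \<delta>; finite S\<rbrakk>
           \<Longrightarrow> (\<Sum>p\<in>S. \<bar>w p x - w p y\<bar>) \<le> L * mdist m x y"
      using w_lip[OF z] by blast
    \<comment> \<open>A ball for both the Lipschitz bound of the weights and the oscillation bound of \<open>f\<close> at \<open>z\<close>.\<close>
    define \<eta> where "\<eta> = min \<delta> (r z)"
    have "\<eta> > 0" using \<open>\<delta> > 0\<close> r_pos[OF z] by (simp add: \<eta>_def)
    have osc: "nrm V (f p \<ominus> f z) \<le> 2 * \<epsilon>" if "w p x \<noteq> 0" "x \<in> A.mball z \<eta>" for p x
    proof -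
      have x: "x \<in> mspace m" "mdist m z x < r z" using that by (auto simp: \<eta>_def)
      have p: "p \<in> mspace m" using w_near that by blast
      have "mdist (norm_metric V) (f p) (f z)
          \<le> mdist (norm_metric V) (f p) (f x) + mdist (norm_metric V) (f x) (f z)"
        using B.triangle fV x p z by blast
      also have "\<dots> \<le> \<epsilon> + \<epsilon>"
        using near[OF that(1) x(1)] r[OF z x] fV p x z
        by (simp add: mdist_norm_metric[symmetric] mdist_commute)
      finally show ?thesis using fV p z by (simp add: mdist_norm_metric)
    qed
    have "mdist (norm_metric V) (g x) (g y) \<le> (L * (2 * \<epsilon>)) * mdist m x y"
      if x: "x \<in> A.mball z \<eta>" and y: "y \<in> A.mball z \<eta>" for x y
    proof -
      have xy: "x \<in> mspace m" "y \<in> mspace m" using x y by auto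
      let ?S = "{p. w p x \<noteq> 0} \<union> {p. w p y \<noteq> 0}"
      have fin: "finite ?S" using w_finite xy by blast
      have fS: "f \<in> ?S \<rightarrow> carrier V" using fp by auto
      \<comment> \<open>The averages at \<open>x\<close> and \<open>y\<close> become comparable as sums over one common index set.\<close>
      have ext: "g u = (\<Oplus>\<^bsub>V\<^esub>p\<in>?S. w p u \<odot> f p)" "(\<Sum>p\<in>?S. w p u) = 1"
        if "u = x \<or> u = y" for u
      proof -
        have sub: "{p. w p u \<noteq> 0} \<subseteq> ?S" using that by auto
        show "g u = (\<Oplus>\<^bsub>V\<^esub>p\<in>?S. w p u \<odot> f p)"
          unfolding g_def
        proof (rule M.add.finprod_mono_neutral_cong_left[OF fin sub])
          show "w p u \<odot> f p = \<zero>" if "p \<in> ?S - {p. w p u \<noteq> 0}" for p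
            using that fS by (auto simp: smult_zero_left Pi_iff)
          show "(\<lambda>p. w p u \<odot> f p) \<in> ?S \<rightarrow> carrier V"
            using fS by (auto simp: Pi_iff)
        qed simp
        have "(\<Sum>p\<in>?S. w p u) = (\<Sum>p | w p u \<noteq> 0. w p u)"
          using fin sub by (intro sum.mono_neutral_right) auto
        then show "(\<Sum>p\<in>?S. w p u) = 1"
          using w_sum xy that by auto
      qed
      have "nrm V ((\<Oplus>\<^bsub>V\<^esub>p\<in>?S. w p x \<odot> f p) \<ominus> (\<Oplus>\<^bsub>V\<^esub>p\<in>?S. w p y \<odot> f p))
          \<le> (\<Sum>p\<in>?S. \<bar>w p x - w p y\<bar>) * (2 * \<epsilon>)"
      proof (rule nrm_combination_diff_le[OF fin fS fV[OF z]])
        show "(\<Sum>p\<in>?S. w p x) = (\<Sum>p\<in>?S. w p y)"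
          using ext(2)[of x] ext(2)[of y] by simp
        show "nrm V (f p \<ominus> f z) \<le> 2 * \<epsilon>" if "p \<in> ?S" for p
          using that osc x y by blast
      qed
      also have "\<dots> \<le> (L * mdist m x y) * (2 * \<epsilon>)"
        using x y fin \<open>0 < \<epsilon>\<close> by (intro mult_right_mono L) (auto simp: \<eta>_def)
      finally show ?thesis
        by (simp add: ext(1)[symmetric] mdist_norm_metric gV mult.assoc mult.left_commute mult.commute)
    qed
    then have "Lipschitz_continuous_map (submetric m (A.mball z \<eta>)) (norm_metric V) g"
      unfolding Lipschitz_continuous_map_def using gV
      by (intro conjI exI[of _ "L * (2 * \<epsilon>)"] ballI) auto
    with \<open>\<eta> > 0\<close> show "\<exists>\<delta>>0. Lipschitz_continuous_map (submetric m (A.mball z \<delta>)) (norm_metric V) g"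
      by blast
  qed
qed

text \<open>
  The supremum in the notion of approximation has to be strictly below \<open>\<epsilon>\<close>, hence the
  approximation within \<open>\<epsilon> / 2\<close>.
\<close>

lemma (in real_normed_space) continuous_imp_CL_approximable:
  fixes m :: "'b metric"
  assumes "mcomplete_of m"
    and "continuous_map (mtopology_of m) (mtopology_of (norm_metric V)) f"
  shows "CL_approximable m (norm_metric V) f"
  unfolding CL_approximable_def
proof (intro allI impI)
  fix \<epsilon> :: real assume "0 < \<epsilon>"
  then obtain g where g: "g \<in> mspace m \<rightarrow> carrier V"
    and le: "\<And>x. x \<in> mspace m \<Longrightarrow> mdist (norm_metric V) (f x) (g x) \<le> \<epsilon> / 2"
    and loc: "\<And>z. z \<in> mspace m \<Longrightarrow> \<exists>\<delta>>0. Lipschitz_continuous_map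
           (submetric m (Metric_space.mball (mspace m) (mdist m) z \<delta>)) (norm_metric V) g"
    using locally_Lipschitz_approximation[OF assms(2), of "\<epsilon> / 2"] by (metis half_gt_zero)
  have "Cauchy_Lipschitz m (norm_metric V) g"
    using g loc by (intro locally_Lipschitz_imp_Cauchy_Lipschitz assms(1)) auto
  moreover have "(SUP x \<in> mspace m. ereal (mdist (norm_metric V) (f x) (g x))) \<le> ereal (\<epsilon> / 2)"
    using le by (intro SUP_least) auto
  then have "(SUP x \<in> mspace m. ereal (mdist (norm_metric V) (f x) (g x))) < ereal \<epsilon>"
    using \<open>0 < \<epsilon>\<close> by (elim order.strict_trans1) auto
  ultimately show "\<exists>g. Cauchy_Lipschitz m (norm_metric V) g \<and>
      (SUP x \<in> mspace m. ereal (mdist (norm_metric V) (f x) (g x))) < ereal \<epsilon>"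
    by blast
qed

section \<open>Obstructions to approximation on incomplete spaces\<close>

context Metric_space
begin

text \<open>
  If terms of arbitrarily large index came arbitrarily near to \<open>x\<close>, the Cauchy property would force
  convergence to \<open>x\<close>.
\<close>

lemma MCauchy_no_limit_finite_near:
  assumes "MCauchy \<sigma>" "\<nexists>l. limitin mtopology \<sigma> l sequentially" "x \<in> M"
  shows "\<exists>\<epsilon>>0. finite {n. d x (\<sigma> n) < \<epsilon>}"
proof (rule ccontr)
  assume "\<not> ?thesis"
  then have inf: "infinite {n. d x (\<sigma> n) < \<epsilon>}" if "\<epsilon> > 0" for \<epsilon> using that by blast
  have ran: "\<sigma> n \<in> M" for n
    using assms(1) by (auto simp: MCauchy_def)
  have "limitin mtopology \<sigma> x sequentially"
    unfolding limitin_metric eventually_sequentially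
  proof (intro conjI allI impI)
    fix \<epsilon> :: real assume "\<epsilon> > 0"
    then obtain N where N: "\<And>n n'. \<lbrakk>N \<le> n; N \<le> n'\<rbrakk> \<Longrightarrow> d (\<sigma> n) (\<sigma> n') < \<epsilon> / 2"
      using assms(1) unfolding MCauchy_def by (meson half_gt_zero)
    have "infinite {n. d x (\<sigma> n) < \<epsilon> / 2}" by (rule inf) (use \<open>\<epsilon> > 0\<close> in simp)
    then obtain k where k: "k \<ge> N" "d x (\<sigma> k) < \<epsilon> / 2"
      unfolding infinite_nat_iff_unbounded_le by blast
    have "d (\<sigma> n) x < \<epsilon>" if "n \<ge> N" for n
      using triangle[of "\<sigma> n" "\<sigma> k" x] N[OF that k(1)] k(2) ran assms(3) commute[of x "\<sigma> k"] by simp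
    then show "\<exists>N. \<forall>n\<ge>N. \<sigma> n \<in> M \<and> d (\<sigma> n) x < \<epsilon>"
      using ran by blast
  qed (rule assms(3))
  with assms(2) show False by blast
qed

text \<open>
  A finite range would mean that one value is attained infinitely often, against the previous lemma
  at that value.
\<close>

lemma MCauchy_no_limit_infinite_range:
  assumes "MCauchy \<sigma>" "\<nexists>l. limitin mtopology \<sigma> l sequentially"
  shows "infinite (range \<sigma>)"
proof
  assume "finite (range \<sigma>)"
  then obtain k where k: "infinite {n. \<sigma> n = \<sigma> k}"
    using pigeonhole_infinite[of UNIV \<sigma>] by auto
  have "\<sigma> k \<in> M" using assms(1) by (auto simp: MCauchy_def)
  then obtain \<epsilon> where "\<epsilon> > 0" "finite {n. d (\<sigma> k) (\<sigma> n) < \<epsilon>}"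
    using MCauchy_no_limit_finite_near[OF assms] by blast
  moreover have "{n. \<sigma> n = \<sigma> k} \<subseteq> {n. d (\<sigma> k) (\<sigma> n) < \<epsilon>}"
    using \<open>\<epsilon> > 0\<close> \<open>\<sigma> k \<in> M\<close> by auto
  ultimately show False using k finite_subset by blast
qed

text \<open>
  Only finitely many indices give terms near any given point of the space, so a point outside
  \<open>S\<close> has a positive distance to \<open>S\<close>.
\<close>

lemma MCauchy_no_limit_closedin:
  assumes "MCauchy \<sigma>" "\<nexists>l. limitin mtopology \<sigma> l sequentially" "S \<subseteq> range \<sigma>"
  shows "closedin mtopology S"
  unfolding closedin_metric
proof (intro conjI allI impI)
  show SM: "S \<subseteq> M" using assms(1,3) by (auto simp: MCauchy_def)
  fix x assume x: "x \<in> M - S"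
  then obtain \<epsilon> where "\<epsilon> > 0" and fin: "finite {n. d x (\<sigma> n) < \<epsilon>}"
    using MCauchy_no_limit_finite_near[OF assms(1,2)] by blast
  \<comment> \<open>Inserting \<open>\<epsilon>\<close> makes the set nonempty and keeps its minimum in the range where only
    finitely many terms compete.\<close>
  define T where "T = insert \<epsilon> ((\<lambda>n. d x (\<sigma> n)) ` {n. d x (\<sigma> n) < \<epsilon> \<and> \<sigma> n \<in> S})"
  have "finite T"
    unfolding T_def by (intro finite.insertI finite_imageI finite_subset[OF _ fin]) auto
  have "0 < t" if "t \<in> T" for t
  proof -
    have "0 < d x (\<sigma> n)" if "\<sigma> n \<in> S" for n
      using that x SM by (intro mdist_pos_less) auto
    then show ?thesis using that \<open>\<epsilon> > 0\<close> by (auto simp: T_def)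
  qed
  then have "Min T > 0"
    using \<open>finite T\<close> by (subst Min_gr_iff) (auto simp: T_def)
  moreover have "disjnt S (mball x (Min T))"
    unfolding disjnt_iff
  proof (intro allI notI, elim conjE)
    fix y assume y: "y \<in> S" "y \<in> mball x (Min T)"
    then obtain n where n: "y = \<sigma> n" using assms(3) by auto
    have "d x (\<sigma> n) < \<epsilon>"
      using y n Min_le[OF \<open>finite T\<close>, of \<epsilon>] by (auto simp: T_def)
    then have "Min T \<le> d x (\<sigma> n)"
      using y n \<open>finite T\<close> by (intro Min_le) (auto simp: T_def)
    with y n show False by auto
  qed
  ultimately show "\<exists>r>0. disjnt S (mball x r)" by blast
qed

text \<open>
  The range is infinite, so it contains two disjoint infinite sets, and both are closed. Urysohn's
  lemma separates them.
\<close>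

lemma MCauchy_no_limit_separate:
  assumes "MCauchy \<sigma>" "\<nexists>l. limitin mtopology \<sigma> l sequentially"
  obtains \<phi> where "continuous_map mtopology (top_of_set {0..1::real}) \<phi>"
    and "infinite {n. \<phi> (\<sigma> n) = 0}" and "infinite {n. \<phi> (\<sigma> n) = 1}"
proof -
  obtain e :: "nat \<Rightarrow> 'a" where e: "inj e" "range e \<subseteq> range \<sigma>"
    using infinite_countable_subset[OF MCauchy_no_limit_infinite_range[OF assms]] by blast
  define A where "A = e ` {k. even k}"
  define B where "B = e ` {k. odd k}"
  have "infinite {k::nat. even k}" "infinite {k::nat. odd k}"
    unfolding infinite_nat_iff_unbounded_le by (metis mem_Collect_eq even_Suc le_SucI order_refl)+
  then have inf: "infinite A" "infinite B"
    using e(1) by (simp_all add: A_def B_def finite_image_iff inj_on_subset)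
  have sub: "A \<subseteq> range \<sigma>" "B \<subseteq> range \<sigma>" using e(2) by (auto simp: A_def B_def)
  have often: "infinite {n. \<sigma> n \<in> C}" if "infinite C" "C \<subseteq> range \<sigma>" for C
  proof
    assume "finite {n. \<sigma> n \<in> C}"
    moreover have "C \<subseteq> \<sigma> ` {n. \<sigma> n \<in> C}" using that(2) by auto
    ultimately show False using that(1) finite_surj by blast
  qed
  have "disjnt A B"
    using e(1) by (auto simp: A_def B_def disjnt_iff dest: injD)
  then obtain \<phi> where \<phi>: "continuous_map mtopology (top_of_set {0..1::real}) \<phi>"
      "\<phi> ` A \<subseteq> {0}" "\<phi> ` B \<subseteq> {1}"
    using Urysohn_lemma[OF normal_space_mtopology MCauchy_no_limit_closedin[OF assms sub(1)]
        MCauchy_no_limit_closedin[OF assms sub(2)], of 0 1] by auto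
  have "{n. \<sigma> n \<in> A} \<subseteq> {n. \<phi> (\<sigma> n) = 0}" "{n. \<sigma> n \<in> B} \<subseteq> {n. \<phi> (\<sigma> n) = 1}"
    using \<phi> by auto
  then show ?thesis
    using that[OF \<phi>(1)] often inf sub infinite_super by metis
qed

end

text \<open>
  A Cauchy-Lipschitz function within \<open>\<epsilon> / 3\<close> of \<open>f\<close> maps the Cauchy sequence to a Cauchy
  sequence, whose terms eventually differ by less than \<open>\<epsilon> / 3\<close>.
\<close>

lemma CL_approximable_imp_Cauchy_oscillation:
  assumes "CL_approximable m1 m2 f" "f \<in> mspace m1 \<rightarrow> mspace m2"
    and "Metric_space.MCauchy (mspace m1) (mdist m1) \<sigma>" "0 < \<epsilon>"
  shows "\<exists>N. \<forall>i\<ge>N. \<forall>j\<ge>N. mdist m2 (f (\<sigma> i)) (f (\<sigma> j)) < \<epsilon>"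
proof -
  interpret A: Metric_space "mspace m1" "mdist m1" by simp
  interpret B: Metric_space "mspace m2" "mdist m2" by simp
  have ran: "\<sigma> i \<in> mspace m1" for i using assms(3) by (auto simp: A.MCauchy_def)
  obtain g where g: "Cauchy_Lipschitz m1 m2 g"
    and sup: "(SUP x \<in> mspace m1. ereal (mdist m2 (f x) (g x))) < ereal (\<epsilon> / 3)"
    using assms(1)[unfolded CL_approximable_def, rule_format, of "\<epsilon> / 3"] \<open>0 < \<epsilon>\<close> by auto
  have close: "mdist m2 (f x) (g x) < \<epsilon> / 3" if "x \<in> mspace m1" for x
    using order.strict_trans1[OF SUP_upper[OF that] sup] by simp
  have gY: "g x \<in> mspace m2" if "x \<in> mspace m1" for x
    using g that by (auto simp: Cauchy_Lipschitz_def)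
  obtain K where "K > 0" and K: "\<And>i j. mdist m2 (g (\<sigma> i)) (g (\<sigma> j)) \<le> K * mdist m1 (\<sigma> i) (\<sigma> j)"
  proof -
    have "Lipschitz_continuous_map (submetric m1 (range \<sigma>)) m2 g"
      using g assms(3) by (simp add: Cauchy_Lipschitz_def)
    moreover have "\<sigma> i \<in> mspace (submetric m1 (range \<sigma>))" for i
      using ran by simp
    ultimately show ?thesis
      using that unfolding Lipschitz_continuous_map_pos mdist_submetric by blast
  qed
  obtain N where N: "\<And>i j. \<lbrakk>N \<le> i; N \<le> j\<rbrakk> \<Longrightarrow> mdist m1 (\<sigma> i) (\<sigma> j) < \<epsilon> / (3 * K)"
    using assms(3)[unfolded A.MCauchy_def, THEN conjunct2, rule_format, of "\<epsilon> / (3 * K)"]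
      \<open>0 < \<epsilon>\<close> \<open>K > 0\<close> by auto
  have "mdist m2 (f (\<sigma> i)) (f (\<sigma> j)) < \<epsilon>" if "N \<le> i" "N \<le> j" for i j
  proof -
    let ?x = "\<sigma> i" and ?y = "\<sigma> j"
    have M: "f ?x \<in> mspace m2" "f ?y \<in> mspace m2" "g ?x \<in> mspace m2" "g ?y \<in> mspace m2"
      using assms(2) gY ran by auto
    have "K * mdist m1 ?x ?y < K * (\<epsilon> / (3 * K))"
      using N[OF that] \<open>K > 0\<close> by (rule mult_strict_left_mono)
    then have "mdist m2 (g ?x) (g ?y) < \<epsilon> / 3"
      using K[of i j] \<open>K > 0\<close> by simp
    moreover have "mdist m2 (g ?y) (f ?y) < \<epsilon> / 3"
      using close[OF ran] by (simp add: mdist_commute)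
    ultimately show ?thesis
      using B.triangle[OF M(1) M(3) M(2)] B.triangle[OF M(3) M(4) M(2)] close[OF ran, of i] by simp
  qed
  then show ?thesis by blast
qed

text \<open>
  The path \<open>L\<close> makes one counterexample serve all target spaces: it carries the real-valued
  separating function into the target, and the compactness of its part over \<open>[0, 1]\<close> gives
  TB-regularity.
\<close>

lemma not_mcomplete_imp_not_CL_approximable:
  fixes L :: "real \<Rightarrow> 'b"
  assumes "\<not> mcomplete_of m1"
    and L: "continuous_map euclideanreal (mtopology_of m2) L" "L 0 \<noteq> L 1"
  obtains f where "continuous_map (mtopology_of m1) (mtopology_of m2) f"
    and "TB_regular m1 m2 f" and "\<not> CL_approximable m1 m2 f"
proof -
  interpret A: Metric_space "mspace m1" "mdist m1" by simp
  interpret B: Metric_space "mspace m2" "mdist m2" by simp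
  obtain \<sigma> where \<sigma>: "A.MCauchy \<sigma>" "\<nexists>l. limitin A.mtopology \<sigma> l sequentially"
    using assms(1) by (auto simp: mcomplete_of_def A.mcomplete_def)
  obtain \<phi> where \<phi>: "continuous_map A.mtopology (top_of_set {0..1::real}) \<phi>"
    and often: "infinite {n. \<phi> (\<sigma> n) = 0}" "infinite {n. \<phi> (\<sigma> n) = 1}"
    using A.MCauchy_no_limit_separate[OF \<sigma>] by blast
  have L01: "L t \<in> mspace m2" for t
    using continuous_map_image_subset_topspace[OF L(1)] by auto
  have "continuous_map A.mtopology euclideanreal \<phi>"
    using \<phi> continuous_map_in_subtopology by blast
  then have cont: "continuous_map (mtopology_of m1) (mtopology_of m2) (L \<circ> \<phi>)"
    using continuous_map_compose L(1) by (simp add: mtopology_of_def) blast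
  have "compactin B.mtopology (L ` {0..1})"
    using image_compactin[OF _ L(1), of "{0..1}"] by (simp add: mtopology_of_def)
  then have tb: "B.mtotally_bounded (L ` {0..1})"
    by (rule B.compactin_imp_mtotally_bounded)
  have \<phi>01: "\<phi> x \<in> {0..1}" if "x \<in> mspace m1" for x
    using continuous_map_image_subset_topspace[OF \<phi>] that by auto
  have "B.mtotally_bounded ((L \<circ> \<phi>) ` S)" if "A.mtotally_bounded S" for S
    using tb A.mtotally_bounded_imp_subset[OF that] \<phi>01
    by (elim B.mtotally_bounded_subset) auto
  then have "TB_regular m1 m2 (L \<circ> \<phi>)"
    using L01 by (auto simp: TB_regular_def)
  moreover have "\<not> CL_approximable m1 m2 (L \<circ> \<phi>)"
  proof
    assume "CL_approximable m1 m2 (L \<circ> \<phi>)"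
    moreover have "L \<circ> \<phi> \<in> mspace m1 \<rightarrow> mspace m2"
      using L01 by auto
    moreover have "0 < mdist m2 (L 0) (L 1)"
      using L(2) L01 by (intro B.mdist_pos_less)
    ultimately obtain N where
      N: "\<And>i j. \<lbrakk>N \<le> i; N \<le> j\<rbrakk> \<Longrightarrow> mdist m2 ((L \<circ> \<phi>) (\<sigma> i)) ((L \<circ> \<phi>) (\<sigma> j)) < mdist m2 (L 0) (L 1)"
      using CL_approximable_imp_Cauchy_oscillation[OF _ _ \<sigma>(1)] by blast
    obtain i j where "N \<le> i" "\<phi> (\<sigma> i) = 0" "N \<le> j" "\<phi> (\<sigma> j) = 1"
      using often unfolding infinite_nat_iff_unbounded_le by blast
    then show False using N[of i j] by simp
  qed
  ultimately show ?thesis using cont that by blast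
qed

section \<open>The real line inside an arbitrary type\<close>

definition real_line_copy :: "(real \<Rightarrow> 'v) \<Rightarrow> 'v normed_module"
  where "real_line_copy e = \<lparr>carrier = range e, mult = (\<lambda>x y. e 0), one = e 0, zero = e 0,
    add = (\<lambda>x y. e (inv_into UNIV e x + inv_into UNIV e y)), smult = (\<lambda>a x. e (a * inv_into UNIV e x)),
    nrm = (\<lambda>x. \<bar>inv_into UNIV e x\<bar>)\<rparr>"

lemma carrier_real_line_copy: "carrier (real_line_copy e) = range e"
  by (simp add: real_line_copy_def)

lemma real_normed_space_real_line_copy:
  assumes "inj e"
  shows "real_normed_space (real_line_copy e)"
proof -
  have "module real_field (real_line_copy e)"
  proof (rule moduleI)
    show "cring real_field"
      by (rule cring_from_type_algebra)
    show "abelian_group (real_line_copy e)"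
    proof (rule abelian_groupI)
      fix x assume "x \<in> carrier (real_line_copy e)"
      then show "\<exists>y\<in>carrier (real_line_copy e). y \<oplus>\<^bsub>real_line_copy e\<^esub> x = \<zero>\<^bsub>real_line_copy e\<^esub>"
        using assms by (intro bexI[of _ "e (- inv_into UNIV e x)"]) (simp_all add: real_line_copy_def)
    qed (use assms in \<open>auto simp: real_line_copy_def algebra_simps\<close>)
  qed (use assms in \<open>auto simp: real_line_copy_def ring_of_type_algebra_def algebra_simps\<close>)
  then show ?thesis
    using assms
    by (intro real_normed_space.intro real_normed_space_axioms.intro)
      (auto simp: real_line_copy_def abs_mult abs_triangle_ineq inj_eq)
qed

lemma mdist_real_line_copy:
  assumes "inj e"
  shows "mdist (norm_metric (real_line_copy e)) (e s) (e t) = \<bar>s - t\<bar>"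
proof -
  interpret real_normed_space "real_line_copy e"
    by (rule real_normed_space_real_line_copy[OF assms])
  have "\<ominus>\<^bsub>real_line_copy e\<^esub> (e t) = e (- t)"
    by (rule M.minus_equality) (use assms in \<open>simp_all add: real_line_copy_def\<close>)
  moreover have "e s \<in> carrier (real_line_copy e)" "e t \<in> carrier (real_line_copy e)"
    by (simp_all add: real_line_copy_def)
  ultimately show ?thesis
    using assms by (simp add: mdist_norm_metric a_minus_def) (simp add: real_line_copy_def)
qed

lemma banach_space_real_line_copy:
  assumes "inj e"
  shows "banach_space (real_line_copy e)"
proof (intro banach_space.intro banach_space_axioms.intro)
  show "real_normed_space (real_line_copy e)"
    by (rule real_normed_space_real_line_copy[OF assms])
  then interpret real_normed_space "real_line_copy e" .
  let ?m = "norm_metric (real_line_copy e)"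
  interpret B: Metric_space "mspace ?m" "mdist ?m"
    by (rule Metric_space_mspace_mdist)
  have car: "mspace ?m = range e" by (simp add: carrier_real_line_copy)
  show "mcomplete_of ?m"
    unfolding mcomplete_of_def B.mcomplete_def
  proof (intro allI impI)
    fix \<sigma> assume \<sigma>: "B.MCauchy \<sigma>"
    define s where "s n = inv_into UNIV e (\<sigma> n)" for n
    have \<sigma>_eq: "\<sigma> n = e (s n)" for n
    proof -
      have "range \<sigma> \<subseteq> mspace ?m"
        using \<sigma> unfolding B.MCauchy_def by (rule conjunct1)
      then have "\<sigma> n \<in> range e"
        unfolding car by blast
      then show ?thesis
        unfolding s_def by (simp add: f_inv_into_f)
    qed
    have "Cauchy s"
      using \<sigma> unfolding B.MCauchy_def Cauchy_def
      by (simp add: \<sigma>_eq mdist_real_line_copy[OF assms] dist_real_def)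
    then obtain l where "s \<longlonglongrightarrow> l"
      using Cauchy_convergent convergent_def by blast
    then have "limitin B.mtopology \<sigma> (e l) sequentially"
      unfolding B.limitin_metric tendsto_iff
      by (simp add: \<sigma>_eq carrier_real_line_copy mdist_real_line_copy[OF assms] dist_real_def)
    then show "\<exists>x. limitin B.mtopology \<sigma> x sequentially" by blast
  qed
qed

lemma continuous_map_real_line_copy:
  assumes "inj e"
  shows "continuous_map euclideanreal (mtopology_of (norm_metric (real_line_copy e))) e"
proof -
  interpret real_normed_space "real_line_copy e"
    by (rule real_normed_space_real_line_copy[OF assms])
  have "Lipschitz_continuous_map euclidean_metric (norm_metric (real_line_copy e)) e"
    unfolding Lipschitz_continuous_map_def
    by (auto simp: mdist_real_line_copy[OF assms] dist_real_def carrier_real_line_copy intro!: exI[of _ 1])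
  from Lipschitz_continuous_imp_continuous_map[OF this] show ?thesis
    by simp
qed

section \<open>Characterization of completeness\<close>

theorem theorem5:
  fixes M :: "'a metric"
  assumes universe: "\<exists>e :: real \<Rightarrow> 'v. inj e"
  shows "(mcomplete_of M \<longleftrightarrow>
          (\<forall>V :: 'v normed_module. banach_space V \<longrightarrow>
            (\<forall>f. continuous_map (mtopology_of M) (mtopology_of (norm_metric V)) f \<and>
                 TB_regular M (norm_metric V) f \<longrightarrow> CL_approximable M (norm_metric V) f)))
       \<and> (mcomplete_of M \<longleftrightarrow>
          (\<forall>f :: 'a \<Rightarrow> real. continuous_map (mtopology_of M) (mtopology_of euclidean_metric) f \<and>
                 TB_regular M euclidean_metric f \<longrightarrow> CL_approximable M euclidean_metric f))"
proof (intro conjI)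
  let ?\<phi>b = "\<forall>V :: 'v normed_module. banach_space V \<longrightarrow>
            (\<forall>f. continuous_map (mtopology_of M) (mtopology_of (norm_metric V)) f \<and>
                 TB_regular M (norm_metric V) f \<longrightarrow> CL_approximable M (norm_metric V) f)"
  let ?\<phi>c = "\<forall>f :: 'a \<Rightarrow> real. continuous_map (mtopology_of M) (mtopology_of euclidean_metric) f \<and>
                 TB_regular M euclidean_metric f \<longrightarrow> CL_approximable M euclidean_metric f"
  show "mcomplete_of M \<longleftrightarrow> ?\<phi>b"
  proof
    assume "mcomplete_of M"
    then show ?\<phi>b
      by (auto simp: banach_space_def intro: real_normed_space.continuous_imp_CL_approximable)
  next
    assume b: ?\<phi>b
    obtain e :: "real \<Rightarrow> 'v" where e: "inj e"
      using universe by blast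
    show "mcomplete_of M"
    proof (rule ccontr)
      assume "\<not> mcomplete_of M"
      moreover have "e 0 \<noteq> e 1"
        using e by (simp add: inj_eq)
      ultimately obtain f where
        "continuous_map (mtopology_of M) (mtopology_of (norm_metric (real_line_copy e))) f"
        "TB_regular M (norm_metric (real_line_copy e)) f"
        "\<not> CL_approximable M (norm_metric (real_line_copy e)) f"
        by (rule not_mcomplete_imp_not_CL_approximable[OF _ continuous_map_real_line_copy[OF e]])
      then show False
        using b banach_space_real_line_copy[OF e] by blast
    qed
  qed
  show "mcomplete_of M \<longleftrightarrow> ?\<phi>c"
  proof
    assume "mcomplete_of M"
    then show ?\<phi>c
      using real_normed_space.continuous_imp_CL_approximable[OF real_normed_space_class_banach, of M]
      unfolding norm_metric_class_banach by blast
  next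
    assume c: ?\<phi>c
    show "mcomplete_of M"
    proof (rule ccontr)
      assume "\<not> mcomplete_of M"
      moreover have "continuous_map euclideanreal (mtopology_of euclidean_metric) (\<lambda>t::real. t)"
        by simp
      ultimately obtain f :: "'a \<Rightarrow> real" where
        "continuous_map (mtopology_of M) (mtopology_of euclidean_metric) f"
        "TB_regular M euclidean_metric f" "\<not> CL_approximable M euclidean_metric f"
        by (rule not_mcomplete_imp_not_CL_approximable) simp
      then show False
        using c by blast
    qed
  qed
qed

end
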